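(* Let $\mathbb{K}$ be a field of characteristic zero and $R$ a unital commutative associative $\mathbb{K}$-algebra. For the $R$-module $\Omega^1_R$ and $X,Y\in T_R$, define the anchor map $$\rho\colon\Omega^1_R\to T_R,\quad\rho(\alpha):=\langle\alpha,Y\rangle X.$$ If the $R$-bilinear mapping $$\Omega^1_R\times\Omega^1_R\to R,\quad(\alpha_1,\alpha_2)\mapsto\langle\alpha_1,Y\rangle\langle\alpha_2,[X,[X,Y]]\rangle$$ is symmetric, then the mapping $$\Omega^1_R\times\Omega^1_R\to\Omega^1_R,\quad(\alpha_1,\alpha_2)\mapsto\alpha_1\cdot\alpha_2:=\nabla_{\alpha_1}\alpha_2:=\langle\alpha_1,Y\rangle\pounds_X\alpha_2-\langle\alpha_1,[X,Y]\rangle\alpha_2$$ defines the structure of a pre-Lie-Rinehart algebra on $\Omega^1_R$ (with anchor $\rho$).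
   Context: $T_R:=\mathrm{Der}(R)$ is the $R$-module and Lie algebra (under commutators) of all $\mathbb{K}$-linear derivations $R\to R$; $\Omega^1_R:=\mathrm{Hom}_R(T_R,R)$; $\langle\alpha,X\rangle:=\alpha(X)$ for $\alpha\in\Omega^1_R$, $X\in T_R$. For $X\in T_R$ the Lie derivative $\pounds_X\colon\Omega^1_R\to\Omega^1_R$ is $(\pounds_X\alpha)(Z):=X(\alpha(Z))-\alpha([X,Z])$ for $Z\in T_R$. For an $R$-module $L$, $$\mathcal{CDO}(L):=\{(D,X)\in\mathrm{End}_{\mathbb{K}}(L)\times\mathrm{Der}(R)\mid D(r\ell)=rD(\ell)+X(r)\ell\text{ for all }r\in R,\ \ell\in L\},$$ an $R$-module via $r\cdot(D,X)=(rD,rX)$. Let $L$ be a unital left $R$-module with an $R$-linear map (anchor) $\rho^L\colon L\to T_R$. A pre-Lie-Rinehart algebra structure on $L$ is an $R$-linear map $\nabla\colon L\to\mathcal{CDO}(L)$ of the form $\nabla(\ell)=(\nabla_\ell,\rho^L(\ell))$ such that, with $\ell_1\cdot\ell_2:=\nabla_{\ell_1}\ell_2$ and $[\ell_1,\ell_2]:=\ell_1\cdot\ell_2-\ell_2\cdot\ell_1$: (a) the associator $(\ell_1,\ell_2,\ell_3):=\ell_1\cdot(\ell_2\cdot\ell_3)-(\ell_1\cdot\ell_2)\cdot\ell_3$ satisfies $(\ell_1,\ell_2,\ell_3)=(\ell_2,\ell_1,\ell_3)$ for all $\ell_1,\ell_2,\ell_3\in L$; (b) $\rho^L([\ell_1,\ell_2])=[\rho^L(\ell_1),\rho^L(\ell_2)]$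 for all $\ell_1,\ell_2\in L$. *)

theory Defs
  imports "HOL-Algebra.Module"
begin

definition char_zero :: "('a, 'e) ring_scheme \<Rightarrow> bool"
  where "char_zero K \<longleftrightarrow> (\<forall>n::nat. n > 0 \<longrightarrow> [n] \<cdot>\<^bsub>K\<^esub> \<one>\<^bsub>K\<^esub> \<noteq> \<zero>\<^bsub>K\<^esub>)"

(* Maps are extensional (undefined outside the carrier of their domain), so that equality of
   maps in HOL is equality of maps on the carrier. The fields mult and one of the module records
   below carry no meaning: the locale module does not refer to them. *)

definition linear_maps ::
  "('r, 'e) ring_scheme \<Rightarrow> ('r, 'm, 'f) module_scheme \<Rightarrow> ('r, 'n, 'g) module_scheme \<Rightarrow> ('m \<Rightarrow> 'n) set"
  where "linear_maps R M N =
    {f \<in> carrier M \<rightarrow>\<^sub>E carrier N.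
      (\<forall>x\<in>carrier M. \<forall>y\<in>carrier M. f (x \<oplus>\<^bsub>M\<^esub> y) = f x \<oplus>\<^bsub>N\<^esub> f y) \<and>
      (\<forall>r\<in>carrier R. \<forall>x\<in>carrier M. f (r \<odot>\<^bsub>M\<^esub> x) = r \<odot>\<^bsub>N\<^esub> f x)}"

definition hom_module ::
  "('r, 'e) ring_scheme \<Rightarrow> ('r, 'm, 'f) module_scheme \<Rightarrow> ('r, 'n, 'g) module_scheme
    \<Rightarrow> ('r, 'm \<Rightarrow> 'n) module"
  where "hom_module R M N =
    \<lparr>carrier = linear_maps R M N, mult = undefined, one = undefined,
     zero = (\<lambda>x\<in>carrier M. \<zero>\<^bsub>N\<^esub>),
     add = (\<lambda>f g. \<lambda>x\<in>carrier M. f x \<oplus>\<^bsub>N\<^esub> g x),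
     smult = (\<lambda>r f. \<lambda>x\<in>carrier M. r \<odot>\<^bsub>N\<^esub> f x)\<rparr>"

definition self_module :: "('r, 'e) ring_scheme \<Rightarrow> ('r, 'r) module"
  where "self_module R =
    \<lparr>carrier = carrier R, mult = mult R, one = one R, zero = zero R, add = add R,
     smult = mult R\<rparr>"

(* A module L over a K-algebra R, regarded as a module over K. *)
definition restrict_scalars ::
  "('k, 'r, 'e) module_scheme \<Rightarrow> ('r, 'l, 'f) module_scheme \<Rightarrow> ('k, 'l) module"
  where "restrict_scalars R L =
    \<lparr>carrier = carrier L, mult = undefined, one = undefined, zero = zero L, add = add L,
     smult = (\<lambda>k l. (k \<odot>\<^bsub>R\<^esub> \<one>\<^bsub>R\<^esub>) \<odot>\<^bsub>L\<^esub> l)\<rparr>"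

definition derivations ::
  "('k, 'e) ring_scheme \<Rightarrow> ('k, 'r, 'f) module_scheme \<Rightarrow> ('r \<Rightarrow> 'r) set"
  where "derivations K R =
    {D \<in> linear_maps K R R. \<forall>f\<in>carrier R. \<forall>g\<in>carrier R.
      D (f \<otimes>\<^bsub>R\<^esub> g) = D f \<otimes>\<^bsub>R\<^esub> g \<oplus>\<^bsub>R\<^esub> f \<otimes>\<^bsub>R\<^esub> D g}"

definition der_module ::
  "('k, 'e) ring_scheme \<Rightarrow> ('k, 'r, 'f) module_scheme \<Rightarrow> ('r, 'r \<Rightarrow> 'r) module"
  where "der_module K R =
    \<lparr>carrier = derivations K R, mult = undefined, one = undefined,
     zero = (\<lambda>f\<in>carrier R. \<zero>\<^bsub>R\<^esub>),
     add = (\<lambda>X Y. \<lambda>f\<in>carrier R. X f \<oplus>\<^bsub>R\<^esub> Y f),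
     smult = (\<lambda>r X. \<lambda>f\<in>carrier R. r \<otimes>\<^bsub>R\<^esub> X f)\<rparr>"

definition der_bracket ::
  "('r, 'e) ring_scheme \<Rightarrow> ('r \<Rightarrow> 'r) \<Rightarrow> ('r \<Rightarrow> 'r) \<Rightarrow> 'r \<Rightarrow> 'r"
  where "der_bracket R X Y = (\<lambda>f\<in>carrier R. X (Y f) \<ominus>\<^bsub>R\<^esub> Y (X f))"

definition one_forms ::
  "('k, 'e) ring_scheme \<Rightarrow> ('k, 'r, 'f) module_scheme \<Rightarrow> ('r, ('r \<Rightarrow> 'r) \<Rightarrow> 'r) module"
  where "one_forms K R = hom_module R (der_module K R) (self_module R)"

definition pairing :: "(('r \<Rightarrow> 'r) \<Rightarrow> 'r) \<Rightarrow> ('r \<Rightarrow> 'r) \<Rightarrow> 'r"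
  where "pairing \<alpha> X = \<alpha> X"

definition lie_derivative ::
  "('k, 'e) ring_scheme \<Rightarrow> ('k, 'r, 'f) module_scheme \<Rightarrow> ('r \<Rightarrow> 'r)
    \<Rightarrow> (('r \<Rightarrow> 'r) \<Rightarrow> 'r) \<Rightarrow> ('r \<Rightarrow> 'r) \<Rightarrow> 'r"
  where "lie_derivative K R X \<alpha> =
    (\<lambda>Z\<in>derivations K R. X (\<alpha> Z) \<ominus>\<^bsub>R\<^esub> \<alpha> (der_bracket R X Z))"

definition cdo_module ::
  "('k, 'e) ring_scheme \<Rightarrow> ('k, 'r, 'f) module_scheme \<Rightarrow> ('r, 'l, 'g) module_scheme
    \<Rightarrow> ('r, ('l \<Rightarrow> 'l) \<times> ('r \<Rightarrow> 'r)) module"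
  where "cdo_module K R L =
    \<lparr>carrier = {(D, X). D \<in> linear_maps K (restrict_scalars R L) (restrict_scalars R L) \<and>
        X \<in> derivations K R \<and>
        (\<forall>r\<in>carrier R. \<forall>l\<in>carrier L. D (r \<odot>\<^bsub>L\<^esub> l) = r \<odot>\<^bsub>L\<^esub> D l \<oplus>\<^bsub>L\<^esub> X r \<odot>\<^bsub>L\<^esub> l)},
     mult = undefined, one = undefined,
     zero = (\<lambda>l\<in>carrier L. \<zero>\<^bsub>L\<^esub>, \<zero>\<^bsub>der_module K R\<^esub>),
     add = (\<lambda>(D, X) (E, Y). (\<lambda>l\<in>carrier L. D l \<oplus>\<^bsub>L\<^esub> E l, X \<oplus>\<^bsub>der_module K R\<^esub> Y)),
     smult = (\<lambda>r (D, X). (\<lambda>l\<in>carrier L. r \<odot>\<^bsub>L\<^esub> D l, r \<odot>\<^bsub>der_module K R\<^esub> X))\<rparr>"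

locale pre_lie_rinehart =
  fixes K :: "('k, 'e) ring_scheme"
    and R :: "('k, 'r, 'f) module_scheme"
    and L :: "('r, 'l, 'g) module_scheme"
    and \<rho> :: "'l \<Rightarrow> 'r \<Rightarrow> 'r"
    and nabla :: "'l \<Rightarrow> ('l \<Rightarrow> 'l) \<times> ('r \<Rightarrow> 'r)"
    and dot :: "'l \<Rightarrow> 'l \<Rightarrow> 'l"
    and bracket :: "'l \<Rightarrow> 'l \<Rightarrow> 'l"
    and assoc :: "'l \<Rightarrow> 'l \<Rightarrow> 'l \<Rightarrow> 'l"
  defines "dot \<equiv> \<lambda>l1 l2. fst (nabla l1) l2"
    and "bracket \<equiv> \<lambda>l1 l2. dot l1 l2 \<ominus>\<^bsub>L\<^esub> dot l2 l1"
    and "assoc \<equiv> \<lambda>l1 l2 l3. dot l1 (dot l2 l3) \<ominus>\<^bsub>L\<^esub> dot (dot l1 l2) l3"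
  assumes base_field: "field K" and base_char_zero: "char_zero K"
    and base_algebra: "algebra K R"
    and module_L: "module R L"
    and anchor_linear: "\<rho> \<in> linear_maps R L (der_module K R)"
    and nabla_linear: "nabla \<in> linear_maps R L (cdo_module K R L)"
    and nabla_anchor: "l \<in> carrier L \<Longrightarrow> snd (nabla l) = \<rho> l"
    and assoc_symmetric:
      "\<lbrakk>l1 \<in> carrier L; l2 \<in> carrier L; l3 \<in> carrier L\<rbrakk> \<Longrightarrow> assoc l1 l2 l3 = assoc l2 l1 l3"
    and anchor_bracket:
      "\<lbrakk>l1 \<in> carrier L; l2 \<in> carrier L\<rbrakk> \<Longrightarrow> \<rho> (bracket l1 l2) = der_bracket R (\<rho> l1) (\<rho> l2)"

end

theory Submission
  imports Defs
begin

text \<open>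
  Write \<open>Y1 = [X, Y]\<close>, \<open>Y2 = [X, Y1]\<close> and \<open>L\<close> for the Lie derivative along \<open>X\<close>, so that
  \<open>\<alpha> \<cdot> \<beta> = \<alpha>(Y) L \<beta> - \<alpha>(Y1) \<beta>\<close>. The operator \<open>L\<close> is a covariant differential operator with symbol \<open>X\<close>,
  that is \<open>L (r \<beta>) = X(r) \<beta> + r L \<beta>\<close>, and multiplication by a ring element is one with symbol \<open>0\<close>.
  Hence \<open>\<beta> \<mapsto> \<alpha> \<cdot> \<beta>\<close> is a covariant differential operator with symbol \<open>\<alpha>(Y) X = \<rho>(\<alpha>)\<close>, and its
  dependence on \<open>\<alpha>\<close> is \<open>R\<close>-linear because \<open>\<alpha>\<close> enters only through \<open>\<alpha>(Y)\<close> and \<open>\<alpha>(Y1)\<close>.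

  The key computation is the associator (lemma \<open>form_connection_associator\<close>). From
  \<open>(L \<beta>)(Y) = X(\<beta>(Y)) - \<beta>(Y1)\<close> and \<open>(L \<beta>)(Y1) = X(\<beta>(Y1)) - \<beta>(Y2)\<close>, all terms in which \<open>X\<close>
  differentiates a coefficient, as well as all terms in \<open>L \<gamma>\<close>, cancel in
  \<open>\<alpha> \<cdot> (\<beta> \<cdot> \<gamma>) - (\<alpha> \<cdot> \<beta>) \<cdot> \<gamma>\<close>, and there remains
  \<open>\<alpha>(Y) \<beta>(Y) L L \<gamma> - \<alpha>(Y) \<beta>(Y2) \<gamma>\<close>.
  The first term is symmetric in \<open>\<alpha>\<close> and \<open>\<beta>\<close>; the coefficient of the second is the bilinear form
  that is assumed to be symmetric. Compatibility of the anchor with brackets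
  (lemma \<open>form_anchor_bracket\<close>) is a first-order computation: evaluating
  \<open>\<alpha> \<cdot> \<beta> - \<beta> \<cdot> \<alpha>\<close> at \<open>Y\<close> gives \<open>\<alpha>(Y) X(\<beta>(Y)) - \<beta>(Y) X(\<alpha>(Y))\<close>, which is the coefficient of \<open>X\<close> in
  \<open>[\<alpha>(Y) X, \<beta>(Y) X]\<close>.

  One-forms are functions on derivations, so each identity between them is checked by evaluating
  at a derivation, where it becomes an identity in the commutative ring \<open>R\<close>.
\<close>

section \<open>Modules of linear maps\<close>

lemma linear_mapsI:
  assumes "f \<in> extensional (carrier M)"
    and "\<And>x. x \<in> carrier M \<Longrightarrow> f x \<in> carrier N"
    and "\<And>x y. \<lbrakk>x \<in> carrier M; y \<in> carrier M\<rbrakk> \<Longrightarrow> f (x \<oplus>\<^bsub>M\<^esub> y) = f x \<oplus>\<^bsub>N\<^esub> f y"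
    and "\<And>r x. \<lbrakk>r \<in> carrier R; x \<in> carrier M\<rbrakk> \<Longrightarrow> f (r \<odot>\<^bsub>M\<^esub> x) = r \<odot>\<^bsub>N\<^esub> f x"
  shows "f \<in> linear_maps R M N"
  using assms by (auto simp: linear_maps_def PiE_def)

lemma linear_mapsD:
  assumes "f \<in> linear_maps R M N"
  shows "f \<in> extensional (carrier M)"
    and "x \<in> carrier M \<Longrightarrow> f x \<in> carrier N"
    and "\<lbrakk>x \<in> carrier M; y \<in> carrier M\<rbrakk> \<Longrightarrow> f (x \<oplus>\<^bsub>M\<^esub> y) = f x \<oplus>\<^bsub>N\<^esub> f y"
    and "\<lbrakk>r \<in> carrier R; x \<in> carrier M\<rbrakk> \<Longrightarrow> f (r \<odot>\<^bsub>M\<^esub> x) = r \<odot>\<^bsub>N\<^esub> f x"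
  using assms by (auto simp: linear_maps_def PiE_def)

lemma hom_module_simps [simp]:
  "carrier (hom_module R M N) = linear_maps R M N"
  "\<zero>\<^bsub>hom_module R M N\<^esub> = (\<lambda>x\<in>carrier M. \<zero>\<^bsub>N\<^esub>)"
  "f \<oplus>\<^bsub>hom_module R M N\<^esub> g = (\<lambda>x\<in>carrier M. f x \<oplus>\<^bsub>N\<^esub> g x)"
  "r \<odot>\<^bsub>hom_module R M N\<^esub> f = (\<lambda>x\<in>carrier M. r \<odot>\<^bsub>N\<^esub> f x)"
  by (simp_all add: hom_module_def)

lemma (in abelian_group) add_minus_add:
  assumes "a \<in> carrier G" "b \<in> carrier G" "c \<in> carrier G" "d \<in> carrier G"
  shows "(a \<oplus> b) \<ominus> (c \<oplus> d) = (a \<ominus> c) \<oplus> (b \<ominus> d)"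
  using assms by (simp add: minus_eq minus_add a_ac)

lemma linear_maps_uminus:
  assumes "module R M" "module R N" "f \<in> linear_maps R M N"
  shows "(\<lambda>x\<in>carrier M. \<ominus>\<^bsub>N\<^esub> f x) \<in> linear_maps R M N"
proof -
  interpret M: module R M by fact
  interpret N: module R N by fact
  note f = linear_mapsD[OF assms(3)]
  show ?thesis
    by (rule linear_mapsI) (simp_all add: f N.minus_add N.smult_r_minus)
qed

lemma module_hom_module:
  assumes "module R M" "module R N"
  shows "module R (hom_module R M N)"
proof -
  interpret M: module R M by fact
  interpret N: module R N by fact
  note D = linear_mapsD[where R = R and M = M and N = N]
  show ?thesis
  proof (rule moduleI)
    show "cring R" by unfold_locales
    show "abelian_group (hom_module R M N)"
    proof (rule abelian_groupI)
      fix f assume f: "f \<in> carrier (hom_module R M N)"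
      show "\<exists>g\<in>carrier (hom_module R M N). g \<oplus>\<^bsub>hom_module R M N\<^esub> f = \<zero>\<^bsub>hom_module R M N\<^esub>"
        using f linear_maps_uminus[OF assms]
        by (intro bexI[of _ "\<lambda>x\<in>carrier M. \<ominus>\<^bsub>N\<^esub> f x"])
          (auto intro!: restrict_ext simp: D N.l_neg)
    qed (auto intro!: linear_mapsI extensionalityI[where A = "carrier M"]
          simp: D N.a_ac N.smult_r_distr)
  qed (auto intro!: linear_mapsI extensionalityI[where A = "carrier M"]
        simp: D N.smult_r_distr N.smult_l_distr N.smult_assoc1[symmetric] M.m_comm)
qed

text \<open>
  Subtraction in a module is defined through the abstract additive inverse, so its pointwise
  description has to be derived from uniqueness of inverses.
\<close>

lemma hom_module_minus:
  assumes "module R M" "module R N" "f \<in> linear_maps R M N" "g \<in> linear_maps R M N"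
    and "x \<in> carrier M"
  shows "(f \<ominus>\<^bsub>hom_module R M N\<^esub> g) x = f x \<ominus>\<^bsub>N\<^esub> g x"
proof -
  interpret N: module R N by fact
  interpret H: module R "hom_module R M N" using assms by (intro module_hom_module)
  have "\<ominus>\<^bsub>hom_module R M N\<^esub> g = (\<lambda>x\<in>carrier M. \<ominus>\<^bsub>N\<^esub> g x)"
    using assms linear_maps_uminus[OF assms(1,2,4)]
    by (intro H.minus_equality) (auto intro!: restrict_ext simp: N.l_neg linear_mapsD(2))
  then show ?thesis
    using assms by (simp add: a_minus_def)
qed

section \<open>Derivations of a commutative algebra\<close>

text \<open>
  Almost all computations take place in \<open>R\<close>, so \<open>R\<close> rather than \<open>K\<close> is made the default structure,
  and the laws of commutative rings refer to it without qualification.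
\<close>

locale commutative_algebra =
  fixes K :: "('k, 'e) ring_scheme" and R :: "('k, 'r, 'f) module_scheme" (structure)
  assumes is_algebra: "algebra K R"

sublocale commutative_algebra \<subseteq> cring R
  using is_algebra by (rule algebra.M_cring)

sublocale commutative_algebra \<subseteq> scalars: module K R
  using is_algebra by (rule algebra.module)

context commutative_algebra
begin

lemma smult_mult:
  assumes "k \<in> carrier K" "x \<in> carrier R" "y \<in> carrier R"
  shows "(k \<odot> x) \<otimes> y = k \<odot> (x \<otimes> y)" and "x \<otimes> (k \<odot> y) = k \<odot> (x \<otimes> y)"
proof -
  interpret A: algebra K R by (rule is_algebra)
  show "(k \<odot> x) \<otimes> y = k \<odot> (x \<otimes> y)"
    using assms by (rule A.smult_assoc2)
  then show "x \<otimes> (k \<odot> y) = k \<odot> (x \<otimes> y)"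
    using assms A.smult_assoc2[of k y x] by (simp add: m_comm)
qed

lemma derivationI:
  assumes "D \<in> extensional (carrier R)"
    and "\<And>f. f \<in> carrier R \<Longrightarrow> D f \<in> carrier R"
    and "\<And>f g. \<lbrakk>f \<in> carrier R; g \<in> carrier R\<rbrakk> \<Longrightarrow> D (f \<oplus> g) = D f \<oplus> D g"
    and "\<And>k f. \<lbrakk>k \<in> carrier K; f \<in> carrier R\<rbrakk> \<Longrightarrow> D (k \<odot> f) = k \<odot> D f"
    and "\<And>f g. \<lbrakk>f \<in> carrier R; g \<in> carrier R\<rbrakk> \<Longrightarrow> D (f \<otimes> g) = D f \<otimes> g \<oplus> f \<otimes> D g"
  shows "D \<in> derivations K R"
  using assms by (auto simp: derivations_def intro!: linear_mapsI)

lemma derivation_linear: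
  assumes "D \<in> derivations K R"
  shows "D \<in> linear_maps K R R"
  using assms by (simp add: derivations_def)

lemma derivation_extensional [simp]:
  "D \<in> derivations K R \<Longrightarrow> D \<in> extensional (carrier R)"
  by (rule linear_mapsD(1)[OF derivation_linear])

lemma derivation_simps [simp]:
  assumes "D \<in> derivations K R"
  shows "f \<in> carrier R \<Longrightarrow> D f \<in> carrier R"
    and "\<lbrakk>f \<in> carrier R; g \<in> carrier R\<rbrakk> \<Longrightarrow> D (f \<oplus> g) = D f \<oplus> D g"
    and "\<lbrakk>k \<in> carrier K; f \<in> carrier R\<rbrakk> \<Longrightarrow> D (k \<odot> f) = k \<odot> D f"
    and "\<lbrakk>f \<in> carrier R; g \<in> carrier R\<rbrakk> \<Longrightarrow> D (f \<otimes> g) = D f \<otimes> g \<oplus> f \<otimes> D g"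
  using linear_mapsD[OF derivation_linear[OF assms]] assms by (auto simp: derivations_def)

lemma derivation_zero [simp]:
  assumes "D \<in> derivations K R"
  shows "D \<zero> = \<zero>"
  using derivation_simps(2)[OF assms, of \<zero> \<zero>] derivation_simps(1)[OF assms, of \<zero>]
  by (simp add: assms add.l_cancel_one)

lemma derivation_minus [simp]:
  assumes D: "D \<in> derivations K R" and "f \<in> carrier R" "g \<in> carrier R"
  shows "D (f \<ominus> g) = D f \<ominus> D g"
proof -
  have "D (\<ominus> g) \<oplus> D g = \<zero>"
    using assms by (simp flip: derivation_simps(2) add: l_neg)
  then have "D (\<ominus> g) = \<ominus> D g"
    using assms by (intro minus_equality[symmetric]) auto
  then show ?thesis
    using assms by (simp add: minus_eq)
qed

text \<open>Derivations kill constants: \<open>D 1 = D (1 \<cdot> 1) = D 1 + D 1\<close>.\<close>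

lemma derivation_scalar [simp]:
  assumes "D \<in> derivations K R" "k \<in> carrier K"
  shows "D (k \<odot> \<one>) = \<zero>"
proof -
  have "D \<one> = \<zero>"
    using derivation_simps(4)[OF assms(1), of \<one> \<one>] derivation_simps(1)[OF assms(1), of \<one>]
    by (simp add: add.l_cancel_one)
  then show ?thesis
    using assms by simp
qed

lemma der_module_simps [simp]:
  "carrier (der_module K R) = derivations K R"
  "\<zero>\<^bsub>der_module K R\<^esub> = (\<lambda>f\<in>carrier R. \<zero>)"
  "X \<oplus>\<^bsub>der_module K R\<^esub> Y = (\<lambda>f\<in>carrier R. X f \<oplus> Y f)"
  "r \<odot>\<^bsub>der_module K R\<^esub> X = (\<lambda>f\<in>carrier R. r \<otimes> X f)"
  by (simp_all add: der_module_def)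

lemma derivation_zero_map: "(\<lambda>f\<in>carrier R. \<zero>) \<in> derivations K R"
  by (rule derivationI) simp_all

lemma derivation_add:
  assumes "X \<in> derivations K R" "Y \<in> derivations K R"
  shows "(\<lambda>f\<in>carrier R. X f \<oplus> Y f) \<in> derivations K R"
  by (rule derivationI)
    (simp_all add: assms a_ac l_distr r_distr scalars.smult_r_distr)

lemma derivation_mult:
  assumes "r \<in> carrier R" "X \<in> derivations K R"
  shows "(\<lambda>f\<in>carrier R. r \<otimes> X f) \<in> derivations K R"
  by (rule derivationI)
    (simp_all add: assms r_distr m_ac smult_mult)

lemma derivation_uminus:
  assumes "X \<in> derivations K R"
  shows "(\<lambda>f\<in>carrier R. \<ominus> X f) \<in> derivations K R"
  by (rule derivationI)
    (simp_all add: assms minus_add l_minus r_minus scalars.smult_r_minus)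

text \<open>
  In both \<open>X (Y (f g))\<close> and \<open>Y (X (f g))\<close> the mixed terms add up to \<open>Y f X g + X f Y g\<close>, so they
  cancel in the difference.
\<close>

lemma der_bracket_derivation [simp]:
  assumes "X \<in> derivations K R" "Y \<in> derivations K R"
  shows "der_bracket R X Y \<in> derivations K R"
proof (rule derivationI)
  fix f g assume fg: "f \<in> carrier R" "g \<in> carrier R"
  note cl = fg derivation_simps(1)[OF assms(1)] derivation_simps(1)[OF assms(2)]
  show "der_bracket R X Y (f \<oplus> g) = der_bracket R X Y f \<oplus> der_bracket R X Y g"
    using cl by (simp add: der_bracket_def assms add_minus_add)
  have cancel: "(a \<otimes> g \<oplus> f \<otimes> b \<oplus> m) \<ominus> (c \<otimes> g \<oplus> f \<otimes> d \<oplus> m) =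
      (a \<ominus> c) \<otimes> g \<oplus> f \<otimes> (b \<ominus> d)"
    if "a \<in> carrier R" "b \<in> carrier R" "c \<in> carrier R" "d \<in> carrier R" "m \<in> carrier R"
    for a b c d m
    using that fg by algebra
  have "X (Y (f \<otimes> g)) =
      (X (Y f) \<otimes> g \<oplus> f \<otimes> X (Y g)) \<oplus> (Y f \<otimes> X g \<oplus> X f \<otimes> Y g)"
    and "Y (X (f \<otimes> g)) =
      (Y (X f) \<otimes> g \<oplus> f \<otimes> Y (X g)) \<oplus> (Y f \<otimes> X g \<oplus> X f \<otimes> Y g)"
    using cl by (simp_all add: assms a_ac)
  then show "der_bracket R X Y (f \<otimes> g) =
      der_bracket R X Y f \<otimes> g \<oplus> f \<otimes> der_bracket R X Y g"
    using cl cancel by (simp add: der_bracket_def assms del: derivation_simps(4))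
next
  fix k f assume "k \<in> carrier K" "f \<in> carrier R"
  then show "der_bracket R X Y (k \<odot> f) = k \<odot> der_bracket R X Y f"
    by (simp add: der_bracket_def assms minus_eq scalars.smult_r_distr scalars.smult_r_minus)
qed (simp_all add: der_bracket_def assms)

lemma der_bracket_add:
  assumes "X \<in> derivations K R" "Y \<in> derivations K R" "Z \<in> derivations K R"
  shows "der_bracket R X (Y \<oplus>\<^bsub>der_module K R\<^esub> Z) =
    der_bracket R X Y \<oplus>\<^bsub>der_module K R\<^esub> der_bracket R X Z"
  by (auto intro!: restrict_ext simp: der_bracket_def assms add_minus_add)

lemma der_bracket_smult:
  assumes "X \<in> derivations K R" "Y \<in> derivations K R" "r \<in> carrier R"
  shows "der_bracket R X (r \<odot>\<^bsub>der_module K R\<^esub> Y) =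
    (X r \<odot>\<^bsub>der_module K R\<^esub> Y) \<oplus>\<^bsub>der_module K R\<^esub> (r \<odot>\<^bsub>der_module K R\<^esub> der_bracket R X Y)"
proof -
  have "X r \<otimes> Y f \<oplus> r \<otimes> X (Y f) \<ominus> r \<otimes> Y (X f) = X r \<otimes> Y f \<oplus> r \<otimes> (X (Y f) \<ominus> Y (X f))"
    if "f \<in> carrier R" for f
    using that by (simp add: assms minus_eq r_distr r_minus a_assoc)
  then show ?thesis
    by (auto intro!: restrict_ext simp: der_bracket_def assms)
qed

lemma module_der_module: "module R (der_module K R)"
proof (rule moduleI)
  show "cring R" by unfold_locales
  show "abelian_group (der_module K R)"
  proof (rule abelian_groupI)
    fix X assume X: "X \<in> carrier (der_module K R)"
    then show "\<exists>Y\<in>carrier (der_module K R). Y \<oplus>\<^bsub>der_module K R\<^esub> X = \<zero>\<^bsub>der_module K R\<^esub>"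
      using derivation_uminus[of X]
      by (intro bexI[of _ "\<lambda>f\<in>carrier R. \<ominus> X f"]) (auto intro!: restrict_ext simp: l_neg)
  qed (auto intro!: extensionalityI[where A = "carrier R"]
      simp: derivation_zero_map derivation_add a_ac)
qed (auto intro!: extensionalityI[where A = "carrier R"]
    simp: derivation_mult derivation_add l_distr r_distr m_assoc)

section \<open>The module of one-forms\<close>

lemma module_self_module: "module R (self_module R)"
proof (rule moduleI)
  show "cring R" by unfold_locales
  show "abelian_group (self_module R)"
    by (rule abelian_groupI) (auto simp: self_module_def a_ac intro: add.l_inv_ex)
qed (simp_all add: self_module_def l_distr r_distr m_assoc)

lemma self_module_minus: "x \<ominus>\<^bsub>self_module R\<^esub> y = x \<ominus> y"
  by (simp add: self_module_def a_minus_def a_inv_def m_inv_def)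

lemma module_one_forms: "module R (one_forms K R)"
  unfolding one_forms_def by (intro module_hom_module module_der_module module_self_module)

lemma one_form_extensional:
  "\<alpha> \<in> carrier (one_forms K R) \<Longrightarrow> \<alpha> \<in> extensional (derivations K R)"
  by (auto simp: one_forms_def dest: linear_mapsD(1))

text \<open>
  Sums and multiples of derivations are written out here as functions on \<open>R\<close>, which is the form
  they have after simplification with \<open>der_module_simps\<close>.
\<close>

lemma one_form_simps [simp]:
  assumes "\<alpha> \<in> carrier (one_forms K R)"
  shows "Z \<in> derivations K R \<Longrightarrow> \<alpha> Z \<in> carrier R"
    and "\<lbrakk>Z \<in> derivations K R; W \<in> derivations K R\<rbrakk>
      \<Longrightarrow> \<alpha> (\<lambda>f\<in>carrier R. Z f \<oplus> W f) = \<alpha> Z \<oplus> \<alpha> W"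
    and "\<lbrakk>r \<in> carrier R; Z \<in> derivations K R\<rbrakk>
      \<Longrightarrow> \<alpha> (\<lambda>f\<in>carrier R. r \<otimes> Z f) = r \<otimes> \<alpha> Z"
  using linear_mapsD(2-4)[of \<alpha> R "der_module K R" "self_module R"] assms
  by (auto simp: one_forms_def self_module_def)

lemma one_formI:
  assumes "\<alpha> \<in> extensional (derivations K R)"
    and "\<And>Z. Z \<in> derivations K R \<Longrightarrow> \<alpha> Z \<in> carrier R"
    and "\<And>Z W. \<lbrakk>Z \<in> derivations K R; W \<in> derivations K R\<rbrakk>
      \<Longrightarrow> \<alpha> (Z \<oplus>\<^bsub>der_module K R\<^esub> W) = \<alpha> Z \<oplus> \<alpha> W"
    and "\<And>r Z. \<lbrakk>r \<in> carrier R; Z \<in> derivations K R\<rbrakk>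
      \<Longrightarrow> \<alpha> (r \<odot>\<^bsub>der_module K R\<^esub> Z) = r \<otimes> \<alpha> Z"
  shows "\<alpha> \<in> carrier (one_forms K R)"
  using assms by (auto simp: one_forms_def self_module_def intro!: linear_mapsI)

lemma one_form_eqI:
  assumes "\<alpha> \<in> carrier (one_forms K R)" "\<beta> \<in> carrier (one_forms K R)"
    and "\<And>Z. Z \<in> derivations K R \<Longrightarrow> \<alpha> Z = \<beta> Z"
  shows "\<alpha> = \<beta>"
  using assms by (intro extensionalityI[where A = "derivations K R"] one_form_extensional)

lemma one_forms_apply [simp]:
  assumes "Z \<in> derivations K R"
  shows "(\<alpha> \<oplus>\<^bsub>one_forms K R\<^esub> \<beta>) Z = \<alpha> Z \<oplus> \<beta> Z"
    and "(r \<odot>\<^bsub>one_forms K R\<^esub> \<alpha>) Z = r \<otimes> \<alpha> Z"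
  using assms by (simp_all add: one_forms_def self_module_def)

lemma one_forms_apply_minus [simp]:
  assumes "\<alpha> \<in> carrier (one_forms K R)" "\<beta> \<in> carrier (one_forms K R)" "Z \<in> derivations K R"
  shows "(\<alpha> \<ominus>\<^bsub>one_forms K R\<^esub> \<beta>) Z = \<alpha> Z \<ominus> \<beta> Z"
  using assms module_der_module module_self_module
  by (simp add: one_forms_def hom_module_minus self_module_minus)

end

sublocale commutative_algebra \<subseteq> forms: module R "one_forms K R"
  by (rule module_one_forms)

section \<open>The Lie derivative of a one-form\<close>

context commutative_algebra
begin

lemma lie_derivative_apply:
  "Z \<in> derivations K R \<Longrightarrow> lie_derivative K R X \<alpha> Z = X (\<alpha> Z) \<ominus> \<alpha> (der_bracket R X Z)"
  by (simp add: lie_derivative_def)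

text \<open>
  Both \<open>Z \<mapsto> X (\<alpha> Z)\<close> and \<open>Z \<mapsto> \<alpha> [X, Z]\<close> fail in general to be \<open>R\<close>-linear, by the same term: replacing
  \<open>Z\<close> by \<open>r Z\<close> produces the extra summand \<open>X r \<alpha> Z\<close> in each, since \<open>[X, r Z] = X r Z + r [X, Z]\<close>.
\<close>

lemma lie_derivative_closed [simp]:
  assumes "X \<in> derivations K R" "\<alpha> \<in> carrier (one_forms K R)"
  shows "lie_derivative K R X \<alpha> \<in> carrier (one_forms K R)"
proof (rule one_formI)
  fix Z W assume ZW: "Z \<in> derivations K R" "W \<in> derivations K R"
  have br: "der_bracket R X Z \<in> derivations K R" "der_bracket R X W \<in> derivations K R"
    using assms ZW by simp_all
  have "\<alpha> (der_bracket R X (\<lambda>f\<in>carrier R. Z f \<oplus> W f)) =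
      \<alpha> (der_bracket R X Z) \<oplus> \<alpha> (der_bracket R X W)"
    using der_bracket_add[of X Z W] assms ZW br by simp
  then show "lie_derivative K R X \<alpha> (Z \<oplus>\<^bsub>der_module K R\<^esub> W) =
      lie_derivative K R X \<alpha> Z \<oplus> lie_derivative K R X \<alpha> W"
    using assms ZW br by (simp add: lie_derivative_apply derivation_add add_minus_add)
next
  fix r Z assume rZ: "r \<in> carrier R" "Z \<in> derivations K R"
  have br: "der_bracket R X Z \<in> derivations K R"
    using assms rZ by simp
  have "\<alpha> (der_bracket R X (\<lambda>f\<in>carrier R. r \<otimes> Z f)) =
      X r \<otimes> \<alpha> Z \<oplus> r \<otimes> \<alpha> (der_bracket R X Z)"
    using der_bracket_smult[of X Z r] assms rZ br
      one_form_simps(2)[OF assms(2), of "\<lambda>f\<in>carrier R. X r \<otimes> Z f"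
        "\<lambda>f\<in>carrier R. r \<otimes> der_bracket R X Z f"]
    by (simp add: derivation_mult cong: restrict_cong)
  moreover have "(x \<otimes> a \<oplus> r \<otimes> y) \<ominus> (x \<otimes> a \<oplus> r \<otimes> b) = r \<otimes> (y \<ominus> b)"
    if "x \<in> carrier R" "a \<in> carrier R" "y \<in> carrier R" "b \<in> carrier R" for x a y b
    using that rZ by algebra
  ultimately show "lie_derivative K R X \<alpha> (r \<odot>\<^bsub>der_module K R\<^esub> Z) =
      r \<otimes> lie_derivative K R X \<alpha> Z"
    using assms rZ br by (simp add: lie_derivative_apply derivation_mult)
qed (use assms in \<open>simp_all add: lie_derivative_def\<close>)

lemma lie_derivative_add:
  assumes "X \<in> derivations K R" "\<alpha> \<in> carrier (one_forms K R)" "\<beta> \<in> carrier (one_forms K R)"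
  shows "lie_derivative K R X (\<alpha> \<oplus>\<^bsub>one_forms K R\<^esub> \<beta>) =
    lie_derivative K R X \<alpha> \<oplus>\<^bsub>one_forms K R\<^esub> lie_derivative K R X \<beta>"
  by (rule one_form_eqI) (simp_all add: assms lie_derivative_apply add_minus_add)

lemma lie_derivative_minus:
  assumes "X \<in> derivations K R" "\<alpha> \<in> carrier (one_forms K R)" "\<beta> \<in> carrier (one_forms K R)"
  shows "lie_derivative K R X (\<alpha> \<ominus>\<^bsub>one_forms K R\<^esub> \<beta>) =
    lie_derivative K R X \<alpha> \<ominus>\<^bsub>one_forms K R\<^esub> lie_derivative K R X \<beta>"
proof (rule one_form_eqI)
  have "(a \<ominus> b) \<ominus> (c \<ominus> d) = (a \<ominus> c) \<ominus> (b \<ominus> d)"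
    if "a \<in> carrier R" "b \<in> carrier R" "c \<in> carrier R" "d \<in> carrier R" for a b c d
    using that by algebra
  then show "lie_derivative K R X (\<alpha> \<ominus>\<^bsub>one_forms K R\<^esub> \<beta>) Z =
      (lie_derivative K R X \<alpha> \<ominus>\<^bsub>one_forms K R\<^esub> lie_derivative K R X \<beta>) Z"
    if "Z \<in> derivations K R" for Z
    using that assms by (simp add: lie_derivative_apply)
qed (simp_all add: assms)

text \<open>
  The term \<open>X r \<alpha>\<close> makes the Lie derivative along \<open>X\<close> a covariant differential operator with
  symbol \<open>X\<close>; it comes from \<open>X (r \<alpha> Z)\<close>, while \<open>(r \<alpha>) [X, Z]\<close> is just \<open>r \<alpha> [X, Z]\<close>.
\<close>

lemma lie_derivative_smult:
  assumes "X \<in> derivations K R" "\<alpha> \<in> carrier (one_forms K R)" "r \<in> carrier R"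
  shows "lie_derivative K R X (r \<odot>\<^bsub>one_forms K R\<^esub> \<alpha>) =
    X r \<odot>\<^bsub>one_forms K R\<^esub> \<alpha> \<oplus>\<^bsub>one_forms K R\<^esub> r \<odot>\<^bsub>one_forms K R\<^esub> lie_derivative K R X \<alpha>"
proof (rule one_form_eqI)
  have "(x \<otimes> a \<oplus> r \<otimes> y) \<ominus> r \<otimes> b = x \<otimes> a \<oplus> r \<otimes> (y \<ominus> b)"
    if "x \<in> carrier R" "a \<in> carrier R" "y \<in> carrier R" "b \<in> carrier R" for x a y b
    using that assms by algebra
  then show "lie_derivative K R X (r \<odot>\<^bsub>one_forms K R\<^esub> \<alpha>) Z =
      (X r \<odot>\<^bsub>one_forms K R\<^esub> \<alpha> \<oplus>\<^bsub>one_forms K R\<^esub> r \<odot>\<^bsub>one_forms K R\<^esub> lie_derivative K R X \<alpha>) Z"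
    if "Z \<in> derivations K R" for Z
    using that assms by (simp add: lie_derivative_apply)
qed (simp_all add: assms)

section \<open>Covariant differential operators\<close>

lemma cdo_module_simps [simp]:
  "(D, X) \<oplus>\<^bsub>cdo_module K R L\<^esub> (E, Y) =
    (\<lambda>l\<in>carrier L. D l \<oplus>\<^bsub>L\<^esub> E l, X \<oplus>\<^bsub>der_module K R\<^esub> Y)"
  "r \<odot>\<^bsub>cdo_module K R L\<^esub> (D, X) = (\<lambda>l\<in>carrier L. r \<odot>\<^bsub>L\<^esub> D l, r \<odot>\<^bsub>der_module K R\<^esub> X)"
  by (simp_all add: cdo_module_def)

text \<open>
  Linearity over the base field is a consequence of the Leibniz rule, because \<open>X\<close> vanishes on
  scalar multiples of the unit.
\<close>

lemma cdo_moduleI: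
  assumes "module R L" and X: "X \<in> derivations K R"
    and "D \<in> extensional (carrier L)"
    and D: "\<And>l. l \<in> carrier L \<Longrightarrow> D l \<in> carrier L"
    and "\<And>l m. \<lbrakk>l \<in> carrier L; m \<in> carrier L\<rbrakk> \<Longrightarrow> D (l \<oplus>\<^bsub>L\<^esub> m) = D l \<oplus>\<^bsub>L\<^esub> D m"
    and leibniz: "\<And>r l. \<lbrakk>r \<in> carrier R; l \<in> carrier L\<rbrakk>
      \<Longrightarrow> D (r \<odot>\<^bsub>L\<^esub> l) = r \<odot>\<^bsub>L\<^esub> D l \<oplus>\<^bsub>L\<^esub> X r \<odot>\<^bsub>L\<^esub> l"
  shows "(D, X) \<in> carrier (cdo_module K R L)"
proof -
  interpret L: module R L by fact
  have "D ((k \<odot> \<one>) \<odot>\<^bsub>L\<^esub> l) = (k \<odot> \<one>) \<odot>\<^bsub>L\<^esub> D l" if "k \<in> carrier K" "l \<in> carrier L" for k l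
    using that leibniz[of "k \<odot> \<one>" l] D X by (simp del: derivation_simps(3))
  then have "D \<in> linear_maps K (restrict_scalars R L) (restrict_scalars R L)"
    using assms by (intro linear_mapsI) (simp_all add: restrict_scalars_def)
  with X leibniz show ?thesis
    by (simp add: cdo_module_def)
qed

section \<open>The connection on one-forms defined by two derivations\<close>

definition form_connection ::
  "('r \<Rightarrow> 'r) \<Rightarrow> ('r \<Rightarrow> 'r) \<Rightarrow> (('r \<Rightarrow> 'r) \<Rightarrow> 'r) \<Rightarrow> (('r \<Rightarrow> 'r) \<Rightarrow> 'r) \<Rightarrow> ('r \<Rightarrow> 'r) \<Rightarrow> 'r"
  where "form_connection X Y \<alpha> = (\<lambda>\<beta>\<in>carrier (one_forms K R).
    pairing \<alpha> Y \<odot>\<^bsub>one_forms K R\<^esub> lie_derivative K R X \<beta>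
    \<ominus>\<^bsub>one_forms K R\<^esub> pairing \<alpha> (der_bracket R X Y) \<odot>\<^bsub>one_forms K R\<^esub> \<beta>)"

definition form_anchor :: "('r \<Rightarrow> 'r) \<Rightarrow> ('r \<Rightarrow> 'r) \<Rightarrow> (('r \<Rightarrow> 'r) \<Rightarrow> 'r) \<Rightarrow> 'r \<Rightarrow> 'r"
  where "form_anchor X Y =
    (\<lambda>\<alpha>\<in>carrier (one_forms K R). pairing \<alpha> Y \<odot>\<^bsub>der_module K R\<^esub> X)"

lemma form_connection_closed [simp]:
  assumes "X \<in> derivations K R" "Y \<in> derivations K R"
    and "\<alpha> \<in> carrier (one_forms K R)" "\<beta> \<in> carrier (one_forms K R)"
  shows "form_connection X Y \<alpha> \<beta> \<in> carrier (one_forms K R)"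
  using assms by (simp add: form_connection_def pairing_def)

lemma form_connection_apply:
  assumes "X \<in> derivations K R" "Y \<in> derivations K R"
    and "\<alpha> \<in> carrier (one_forms K R)" "\<beta> \<in> carrier (one_forms K R)" "Z \<in> derivations K R"
  shows "form_connection X Y \<alpha> \<beta> Z =
    \<alpha> Y \<otimes> lie_derivative K R X \<beta> Z \<ominus> \<alpha> (der_bracket R X Y) \<otimes> \<beta> Z"
  using assms by (simp add: form_connection_def pairing_def)

lemma form_anchor_apply:
  assumes "\<alpha> \<in> carrier (one_forms K R)" "f \<in> carrier R"
  shows "form_anchor X Y \<alpha> f = \<alpha> Y \<otimes> X f"
  using assms by (simp add: form_anchor_def pairing_def)

lemma form_anchor_derivation:
  assumes "X \<in> derivations K R" "Y \<in> derivations K R" "\<alpha> \<in> carrier (one_forms K R)"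
  shows "form_anchor X Y \<alpha> \<in> derivations K R"
  using assms by (simp add: form_anchor_def pairing_def derivation_mult)

lemma form_anchor_linear:
  assumes "X \<in> derivations K R" "Y \<in> derivations K R"
  shows "form_anchor X Y \<in> linear_maps R (one_forms K R) (der_module K R)"
  using assms
  by (intro linear_mapsI)
    (auto simp: form_anchor_def pairing_def derivation_mult l_distr m_assoc intro!: restrict_ext)

lemma form_connection_cdo:
  assumes X: "X \<in> derivations K R" and Y: "Y \<in> derivations K R"
    and \<alpha>: "\<alpha> \<in> carrier (one_forms K R)"
  shows "(form_connection X Y \<alpha>, form_anchor X Y \<alpha>) \<in> carrier (cdo_module K R (one_forms K R))"
proof (rule cdo_moduleI)
  show "module R (one_forms K R)" by unfold_locales
  show "form_connection X Y \<alpha> \<in> extensional (carrier (one_forms K R))"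
    by (simp add: form_connection_def)
next
  fix \<beta> \<gamma> assume \<beta>\<gamma>: "\<beta> \<in> carrier (one_forms K R)" "\<gamma> \<in> carrier (one_forms K R)"
  have *: "a \<otimes> (x \<oplus> y) \<ominus> b \<otimes> (s \<oplus> t) = (a \<otimes> x \<ominus> b \<otimes> s) \<oplus> (a \<otimes> y \<ominus> b \<otimes> t)"
    if "a \<in> carrier R" "b \<in> carrier R" "x \<in> carrier R" "y \<in> carrier R" "s \<in> carrier R"
      "t \<in> carrier R" for a b x y s t
    using that by algebra
  show "form_connection X Y \<alpha> (\<beta> \<oplus>\<^bsub>one_forms K R\<^esub> \<gamma>) =
      form_connection X Y \<alpha> \<beta> \<oplus>\<^bsub>one_forms K R\<^esub> form_connection X Y \<alpha> \<gamma>"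
    by (rule one_form_eqI)
      (simp_all add: assms \<beta>\<gamma> form_connection_apply lie_derivative_add *)
next
  fix r \<beta> assume r: "r \<in> carrier R" and \<beta>: "\<beta> \<in> carrier (one_forms K R)"
  have *: "a \<otimes> (x \<otimes> s \<oplus> r \<otimes> y) \<ominus> b \<otimes> (r \<otimes> s) = r \<otimes> (a \<otimes> y \<ominus> b \<otimes> s) \<oplus> a \<otimes> x \<otimes> s"
    if "a \<in> carrier R" "b \<in> carrier R" "x \<in> carrier R" "y \<in> carrier R" "s \<in> carrier R"
    for a b x y s
    using that r by algebra
  show "form_connection X Y \<alpha> (r \<odot>\<^bsub>one_forms K R\<^esub> \<beta>) =
      r \<odot>\<^bsub>one_forms K R\<^esub> form_connection X Y \<alpha> \<beta>
      \<oplus>\<^bsub>one_forms K R\<^esub> form_anchor X Y \<alpha> r \<odot>\<^bsub>one_forms K R\<^esub> \<beta>"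
    by (rule one_form_eqI)
      (simp_all add: assms r \<beta> form_connection_apply form_anchor_apply lie_derivative_smult *)
qed (simp_all add: assms form_anchor_derivation)

lemma form_connection_linear:
  assumes X: "X \<in> derivations K R" and Y: "Y \<in> derivations K R"
  shows "(\<lambda>\<alpha>\<in>carrier (one_forms K R). (form_connection X Y \<alpha>, form_anchor X Y \<alpha>))
    \<in> linear_maps R (one_forms K R) (cdo_module K R (one_forms K R))"
    (is "?nabla \<in> _")
proof (rule linear_mapsI)
  fix \<alpha> \<beta> assume \<alpha>\<beta>: "\<alpha> \<in> carrier (one_forms K R)" "\<beta> \<in> carrier (one_forms K R)"
  have *: "(a \<oplus> b) \<otimes> x \<ominus> (c \<oplus> d) \<otimes> y = (a \<otimes> x \<ominus> c \<otimes> y) \<oplus> (b \<otimes> x \<ominus> d \<otimes> y)"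
    if "a \<in> carrier R" "b \<in> carrier R" "c \<in> carrier R" "d \<in> carrier R" "x \<in> carrier R"
      "y \<in> carrier R" for a b c d x y
    using that by algebra
  have "form_connection X Y (\<alpha> \<oplus>\<^bsub>one_forms K R\<^esub> \<beta>) \<gamma> =
      form_connection X Y \<alpha> \<gamma> \<oplus>\<^bsub>one_forms K R\<^esub> form_connection X Y \<beta> \<gamma>"
    if "\<gamma> \<in> carrier (one_forms K R)" for \<gamma>
    by (rule one_form_eqI) (simp_all add: assms \<alpha>\<beta> that form_connection_apply *)
  then have "form_connection X Y (\<alpha> \<oplus>\<^bsub>one_forms K R\<^esub> \<beta>) = (\<lambda>\<gamma>\<in>carrier (one_forms K R).
      form_connection X Y \<alpha> \<gamma> \<oplus>\<^bsub>one_forms K R\<^esub> form_connection X Y \<beta> \<gamma>)"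
    by (intro extensionalityI[where A = "carrier (one_forms K R)"])
      (simp_all add: form_connection_def)
  then show "?nabla (\<alpha> \<oplus>\<^bsub>one_forms K R\<^esub> \<beta>) =
      ?nabla \<alpha> \<oplus>\<^bsub>cdo_module K R (one_forms K R)\<^esub> ?nabla \<beta>"
    using linear_mapsD(3)[OF form_anchor_linear[OF X Y] \<alpha>\<beta>] \<alpha>\<beta> by simp
next
  fix r \<alpha> assume r: "r \<in> carrier R" and \<alpha>: "\<alpha> \<in> carrier (one_forms K R)"
  have *: "r \<otimes> a \<otimes> x \<ominus> r \<otimes> b \<otimes> y = r \<otimes> (a \<otimes> x \<ominus> b \<otimes> y)"
    if "a \<in> carrier R" "b \<in> carrier R" "x \<in> carrier R" "y \<in> carrier R" for a b x y
    using that r by algebra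
  have "form_connection X Y (r \<odot>\<^bsub>one_forms K R\<^esub> \<alpha>) \<gamma> =
      r \<odot>\<^bsub>one_forms K R\<^esub> form_connection X Y \<alpha> \<gamma>"
    if "\<gamma> \<in> carrier (one_forms K R)" for \<gamma>
    by (rule one_form_eqI) (simp_all add: assms r \<alpha> that form_connection_apply *)
  then have "form_connection X Y (r \<odot>\<^bsub>one_forms K R\<^esub> \<alpha>) =
      (\<lambda>\<gamma>\<in>carrier (one_forms K R). r \<odot>\<^bsub>one_forms K R\<^esub> form_connection X Y \<alpha> \<gamma>)"
    by (intro extensionalityI[where A = "carrier (one_forms K R)"])
      (simp_all add: form_connection_def)
  then show "?nabla (r \<odot>\<^bsub>one_forms K R\<^esub> \<alpha>) =
      r \<odot>\<^bsub>cdo_module K R (one_forms K R)\<^esub> ?nabla \<alpha>"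
    using linear_mapsD(4)[OF form_anchor_linear[OF X Y] r \<alpha>] r \<alpha> by simp
qed (simp_all add: assms form_connection_cdo)

text \<open>
  Expanding \<open>L (\<beta> \<cdot> \<gamma>)\<close> with the Leibniz rule expresses both sides at \<open>Z\<close> through the values of
  \<open>\<gamma>\<close>, \<open>L \<gamma>\<close> and \<open>L (L \<gamma>)\<close> at \<open>Z\<close>. The coefficients of \<open>L \<gamma>\<close> cancel completely; in the
  coefficient of \<open>\<gamma>\<close> only the double bracket contained in \<open>(L \<beta>) [X, Y]\<close> survives.
\<close>

lemma form_connection_associator:
  assumes X: "X \<in> derivations K R" and Y: "Y \<in> derivations K R"
    and \<alpha>: "\<alpha> \<in> carrier (one_forms K R)" and \<beta>: "\<beta> \<in> carrier (one_forms K R)"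
    and \<gamma>: "\<gamma> \<in> carrier (one_forms K R)"
  shows "form_connection X Y \<alpha> (form_connection X Y \<beta> \<gamma>)
      \<ominus>\<^bsub>one_forms K R\<^esub> form_connection X Y (form_connection X Y \<alpha> \<beta>) \<gamma> =
    (\<alpha> Y \<otimes> \<beta> Y) \<odot>\<^bsub>one_forms K R\<^esub> lie_derivative K R X (lie_derivative K R X \<gamma>)
      \<ominus>\<^bsub>one_forms K R\<^esub> (\<alpha> Y \<otimes> \<beta> (der_bracket R X (der_bracket R X Y))) \<odot>\<^bsub>one_forms K R\<^esub> \<gamma>"
    (is "?lhs = ?rhs")
proof (rule one_form_eqI)
  fix Z assume Z: "Z \<in> derivations K R"
  define Y1 where "Y1 = der_bracket R X Y"
  define Y2 where "Y2 = der_bracket R X Y1"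
  define L where "L = lie_derivative K R X"
  have Y12: "Y1 \<in> derivations K R" "Y2 \<in> derivations K R"
    using X Y by (simp_all add: Y1_def Y2_def)
  have L: "L \<delta> \<in> carrier (one_forms K R)" if "\<delta> \<in> carrier (one_forms K R)" for \<delta>
    using that X by (simp add: L_def)
  have conn: "form_connection X Y \<delta> \<epsilon> W = \<delta> Y \<otimes> L \<epsilon> W \<ominus> \<delta> Y1 \<otimes> \<epsilon> W"
    if "\<delta> \<in> carrier (one_forms K R)" "\<epsilon> \<in> carrier (one_forms K R)" "W \<in> derivations K R"
    for \<delta> \<epsilon> W
    using that X Y by (simp add: form_connection_apply L_def Y1_def)
  have LY: "L \<beta> Y = X (\<beta> Y) \<ominus> \<beta> Y1" and LY1: "L \<beta> Y1 = X (\<beta> Y1) \<ominus> \<beta> Y2"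
    using Y Y12 by (simp_all add: L_def Y1_def Y2_def lie_derivative_apply)
  have "form_connection X Y \<beta> \<gamma> =
      \<beta> Y \<odot>\<^bsub>one_forms K R\<^esub> L \<gamma> \<ominus>\<^bsub>one_forms K R\<^esub> \<beta> Y1 \<odot>\<^bsub>one_forms K R\<^esub> \<gamma>"
    using \<gamma> by (simp add: form_connection_def pairing_def L_def Y1_def)
  then have "L (form_connection X Y \<beta> \<gamma>) Z =
      (X (\<beta> Y) \<otimes> L \<gamma> Z \<oplus> \<beta> Y \<otimes> L (L \<gamma>) Z) \<ominus> (X (\<beta> Y1) \<otimes> \<gamma> Z \<oplus> \<beta> Y1 \<otimes> L \<gamma> Z)"
    using X Y Y12 \<beta> \<gamma> Z L by (simp add: L_def lie_derivative_minus lie_derivative_smult)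
  \<comment> \<open>Here \<open>a, a1\<close> and \<open>b, b1, b2\<close> stand for the values of \<open>\<alpha>\<close> and \<open>\<beta>\<close> at \<open>Y, Y1, Y2\<close>, \<open>x, y\<close> for
    \<open>X (\<beta> Y), X (\<beta> Y1)\<close>, and \<open>l0, l1, l2\<close> for the values of \<open>\<gamma>\<close>, \<open>L \<gamma>\<close>, \<open>L (L \<gamma>)\<close> at \<open>Z\<close>.\<close>
  moreover have "(a \<otimes> ((x \<otimes> l1 \<oplus> b \<otimes> l2) \<ominus> (y \<otimes> l0 \<oplus> b1 \<otimes> l1)) \<ominus> a1 \<otimes> (b \<otimes> l1 \<ominus> b1 \<otimes> l0))
      \<ominus> ((a \<otimes> (x \<ominus> b1) \<ominus> a1 \<otimes> b) \<otimes> l1 \<ominus> (a \<otimes> (y \<ominus> b2) \<ominus> a1 \<otimes> b1) \<otimes> l0) =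
      a \<otimes> b \<otimes> l2 \<ominus> a \<otimes> b2 \<otimes> l0"
    if "a \<in> carrier R" "a1 \<in> carrier R" "b \<in> carrier R" "b1 \<in> carrier R" "b2 \<in> carrier R"
      "x \<in> carrier R" "y \<in> carrier R" "l0 \<in> carrier R" "l1 \<in> carrier R" "l2 \<in> carrier R"
    for a a1 b b1 b2 x y l0 l1 l2
    using that by algebra
  ultimately show "?lhs Z = ?rhs Z"
    using X Y Y12 \<alpha> \<beta> \<gamma> Z L
    by (simp add: conn LY LY1 flip: L_def Y1_def Y2_def)
qed (use assms in simp_all)

text \<open>
  The terms with \<open>[X, Y]\<close> in \<open>\<alpha> \<cdot> \<beta>\<close>, evaluated at \<open>Y\<close>, form an expression symmetric in \<open>\<alpha>\<close> and
  \<open>\<beta>\<close>, so they drop out of the commutator; on the other side the second derivatives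
  \<open>\<alpha> Y \<beta> Y X (X f)\<close> cancel.
\<close>

lemma form_anchor_bracket:
  assumes X: "X \<in> derivations K R" and Y: "Y \<in> derivations K R"
    and \<alpha>: "\<alpha> \<in> carrier (one_forms K R)" and \<beta>: "\<beta> \<in> carrier (one_forms K R)"
  shows "form_anchor X Y (form_connection X Y \<alpha> \<beta> \<ominus>\<^bsub>one_forms K R\<^esub> form_connection X Y \<beta> \<alpha>) =
    der_bracket R (form_anchor X Y \<alpha>) (form_anchor X Y \<beta>)"
proof (rule extensionalityI[where A = "carrier R"])
  fix f assume f: "f \<in> carrier R"
  \<comment> \<open>Here \<open>a, a1, x\<close> stand for \<open>\<alpha> Y, \<alpha> [X, Y], X (\<alpha> Y)\<close>, likewise \<open>b, b1, y\<close> for \<open>\<beta>\<close>, and \<open>g, h\<close> for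
    \<open>X f, X (X f)\<close>.\<close>
  have cancel: "((a \<otimes> (y \<ominus> b1) \<ominus> a1 \<otimes> b) \<ominus> (b \<otimes> (x \<ominus> a1) \<ominus> b1 \<otimes> a)) \<otimes> g =
      a \<otimes> (y \<otimes> g \<oplus> b \<otimes> h) \<ominus> b \<otimes> (x \<otimes> g \<oplus> a \<otimes> h)"
    if "a \<in> carrier R" "a1 \<in> carrier R" "b \<in> carrier R" "b1 \<in> carrier R"
      "x \<in> carrier R" "y \<in> carrier R" "g \<in> carrier R" "h \<in> carrier R"
    for a a1 b b1 x y g h
    using that by algebra
  show "form_anchor X Y
        (form_connection X Y \<alpha> \<beta> \<ominus>\<^bsub>one_forms K R\<^esub> form_connection X Y \<beta> \<alpha>) f =
      der_bracket R (form_anchor X Y \<alpha>) (form_anchor X Y \<beta>) f"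
    using assms f
    by (simp add: form_anchor_apply form_connection_apply lie_derivative_apply
        cancel[where h = "X (X f)"] der_bracket_def[of R "form_anchor X Y \<alpha>"])
qed (use assms in \<open>simp_all add: form_anchor_derivation\<close>)

end

theorem corollary4p16:
  fixes K :: "('k, 'e) ring_scheme"
    and R :: "('k, 'r, 'f) module_scheme"
    and X Y :: "'r \<Rightarrow> 'r"
  assumes "field K" and "char_zero K" and "algebra K R"
    and "X \<in> carrier (der_module K R)" and "Y \<in> carrier (der_module K R)"
    and symmetric: "\<forall>\<alpha>\<^sub>1\<in>carrier (one_forms K R). \<forall>\<alpha>\<^sub>2\<in>carrier (one_forms K R).
      pairing \<alpha>\<^sub>1 Y \<otimes>\<^bsub>R\<^esub> pairing \<alpha>\<^sub>2 (der_bracket R X (der_bracket R X Y)) =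
      pairing \<alpha>\<^sub>2 Y \<otimes>\<^bsub>R\<^esub> pairing \<alpha>\<^sub>1 (der_bracket R X (der_bracket R X Y))"
  shows "let \<Omega> = one_forms K R;
             \<rho> = (\<lambda>\<alpha>\<in>carrier \<Omega>. pairing \<alpha> Y \<odot>\<^bsub>der_module K R\<^esub> X);
             dot = (\<lambda>\<alpha>\<^sub>1. \<lambda>\<alpha>\<^sub>2\<in>carrier \<Omega>.
               pairing \<alpha>\<^sub>1 Y \<odot>\<^bsub>\<Omega>\<^esub> lie_derivative K R X \<alpha>\<^sub>2
               \<ominus>\<^bsub>\<Omega>\<^esub> pairing \<alpha>\<^sub>1 (der_bracket R X Y) \<odot>\<^bsub>\<Omega>\<^esub> \<alpha>\<^sub>2)
         in pre_lie_rinehart K R \<Omega> \<rho> (\<lambda>\<alpha>\<in>carrier \<Omega>. (dot \<alpha>, \<rho> \<alpha>))"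
proof -
  interpret commutative_algebra K R
    using \<open>algebra K R\<close> by (rule commutative_algebra.intro)
  have X: "X \<in> derivations K R" and Y: "Y \<in> derivations K R"
    using assms(4,5) by simp_all
  have "pre_lie_rinehart K R (one_forms K R) (form_anchor X Y)
    (\<lambda>\<alpha>\<in>carrier (one_forms K R). (form_connection X Y \<alpha>, form_anchor X Y \<alpha>))"
    (is "pre_lie_rinehart K R _ _ ?nabla")
  proof (rule pre_lie_rinehart.intro)
    fix \<alpha> \<beta> \<gamma>
    assume \<alpha>\<beta>\<gamma>: "\<alpha> \<in> carrier (one_forms K R)" "\<beta> \<in> carrier (one_forms K R)"
      "\<gamma> \<in> carrier (one_forms K R)"
    have "form_connection X Y \<alpha> (form_connection X Y \<beta> \<gamma>)
        \<ominus>\<^bsub>one_forms K R\<^esub> form_connection X Y (form_connection X Y \<alpha> \<beta>) \<gamma> =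
      form_connection X Y \<beta> (form_connection X Y \<alpha> \<gamma>)
        \<ominus>\<^bsub>one_forms K R\<^esub> form_connection X Y (form_connection X Y \<beta> \<alpha>) \<gamma>"
      using symmetric[unfolded pairing_def, rule_format, of \<alpha> \<beta>] X Y \<alpha>\<beta>\<gamma>
      by (simp add: form_connection_associator m_comm[of "\<beta> Y" "\<alpha> Y"])
    then show "fst (?nabla \<alpha>) (fst (?nabla \<beta>) \<gamma>)
          \<ominus>\<^bsub>one_forms K R\<^esub> fst (?nabla (fst (?nabla \<alpha>) \<beta>)) \<gamma> =
        fst (?nabla \<beta>) (fst (?nabla \<alpha>) \<gamma>)
          \<ominus>\<^bsub>one_forms K R\<^esub> fst (?nabla (fst (?nabla \<beta>) \<alpha>)) \<gamma>"
      using X Y \<alpha>\<beta>\<gamma> by simp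
  qed (use assms(1-3) X Y in \<open>simp_all add: form_anchor_linear form_connection_linear
      form_anchor_bracket module_one_forms\<close>)
  then show ?thesis
    unfolding form_connection_def form_anchor_def by (simp only: Let_def)
qed

end
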